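(* Let $G=(\Lambda,\{S^i\}_{i\in\Lambda},\{F^i\}_{i\in\Lambda})$ be a multiobjective interval-valued noncooperative game with $\Lambda=\{1,\dots,l\}$, strategy sets $S^i=\{u\in\mathbb{R}^n:g^i_j(u)\le0,\ j\in J\}$, $J=\{1,\dots,p\}$, and loss functions $F^i=(F^i_1,\dots,F^i_m)$, $K=\{1,\dots,m\}$. Let $\varepsilon=(\varepsilon_1,\dots,\varepsilon_m)\in\mathbb{R}^m_+\setminus\{0\}$ and let $\overline{u}=(\overline{u}_1,\dots,\overline{u}_l)\in\widehat{S}=\prod_{i\in\Lambda}S^i$ be a weak $\varepsilon$-Nash equilibrium of $G$. Suppose that for each $i\in\Lambda$, $F^i_k(\cdot,\overline{u}_{-i})$ and $g^i_j$ are locally Lipschitz continuous on $\mathbb{R}^n$ for all $k\in K$ and $j\in J$. Moreover, given $\delta>0$, suppose that for all $i\in\Lambda$, BCQ holds (for the constraints $g^i_j$) at every point of $\overline{B}^i(\overline{u}_i,\delta):=\{x\in S^i:\|x-\overline{u}_i\|\leq\delta\}$. Then, for every $i\in\Lambda$, there exist $x_\delta^i\in \overline{B}^i(\overline{u}_i,\delta)$, $\lambda^i=(\lambda^i_1,\dots,\lambda^i_m)\in\mathbb{R}^m_+$ with $\sum_{k\in K}\lambda^i_k=1$, and $\mu^i=(\mu^i_1,\dots,\mu^i_p)\in\mathbb{R}^p_+$ such that $$0\in\sum_{k\in K}\lambda^i_k\partial^0 F^i_k(x_\delta^i,\overline{u}_{-i})+\sum_{j\in I(x_\delta^i)}\mu^i_j\partial^0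 g^i_j(x_\delta^i)+\frac{1}{\delta}\max_{k\in K}\{\varepsilon_k\}\,\mathbb{B}^n,\qquad \mu^i_jg^i_j(x_\delta^i)=0\ \ \forall j\in J.$$
   Context: $\mathcal{I}$ is the set of all compact intervals $[\underline q,\overline q]$ with $\underline q\le\overline q$ real. For $Q=[\underline q,\overline q]\in\mathcal I$ put $q^c=\frac{\underline q+\overline q}{2}$ and $q^w=\frac{\overline q-\underline q}{2}$. Addition: $[\underline q,\overline q]+[\underline r,\overline r]=[\underline q+\underline r,\overline q+\overline r]$. Order: $Q\prec_{CW}R$ iff $q^c<r^c$ and $q^w<r^w$. $\mathbb{R}^m_+$ is the nonnegative orthant; $\mathbb{B}^n$ is the closed unit ball of $\mathbb{R}^n$; $\mathrm{co}$ denotes convex hull. An interval-valued function $f=[\underline f,\overline f]:\mathbb{R}^n\to\mathcal I$ is locally Lipschitz continuous if every point has a neighbourhood $U$ and $L>0$ with $\max\{|\underline f(u_1)-\underline f(u_2)|,|\overline f(u_1)-\overline f(u_2)|\}\le L\|u_1-u_2\|$ for $u_1,u_2\in U$. Write $f^c=\frac{\underline f+\overline f}{2}$, $f^w=\frac{\overline f-\underline f}{2}$. For locally Lipschitz $\psi:\mathbb{R}^n\to\mathbb{R}$, $\psi^0(z;w)=\limsup_{u\to z,\,t\to0^+}\frac{\psi(u+tw)-\psi(u)}{t}$ and $\partial^0\psi(z)=\{z^*:\langle z^*,w\rangle\le\psi^0(z;w)\ \forall w\in\mathbb{R}^n\}$ (Clarke gradient). For locally Lipschitz interval-valued $f$,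 $\partial^0f(u):=\mathrm{co}(\partial^0f^c(u)\cup\partial^0f^w(u))$. Game: $g^i_j:\mathbb{R}^n\to\mathbb{R}$; each $F^i_k$ is an $\mathcal I$-valued function of strategy profiles $u=(u_1,\dots,u_l)$. For a profile $\overline u$, $\overline u_{-i}$ is $\overline u$ with the $i$-th component removed, and $(u_i,\overline u_{-i})$ is $\overline u$ with the $i$-th component replaced by $u_i$. For fixed $\overline u_{-i}$, $F^i_k(\cdot,\overline u_{-i})$ is regarded as defined on all of $\mathbb{R}^n$, and $\partial^0F^i_k(x,\overline u_{-i})$ is the gradient at $x$ of $F^i_k(\cdot,\overline u_{-i})$. $\overline u\in\widehat S$ is a weak $\varepsilon$-Nash equilibrium if for every $i\in\Lambda$ there is no $y_i\in S^i$ with $F^i_k(y_i,\overline u_{-i})+[0,\varepsilon_k]\prec_{CW}F^i_k(\overline u)$ for all $k\in K$. For $x\in S^i$, $I(x):=\{j\in J:g^i_j(x)=0\}$. BCQ holds at $x\in S^i$ if there is no $\mu\in\mathbb{R}^p_+\setminus\{0\}$ with $\mu_j\ge0$ for $j\in I(x)$, $\mu_j=0$ for $j\notin I(x)$ and $0\in\sum_{j\in J}\mu_j\partial^0g^i_j(x)$. A sum over an empty index set is $\{0\}$. *)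

theory Defs
  imports "HOL-Analysis.Analysis" "HOL-Library.Interval"
begin

definition center :: "real interval \<Rightarrow> real" where
  "center Q = (lower Q + upper Q) / 2"

text \<open>The half-width; the library's \<^const>\<open>width\<close> is twice this number.\<close>

definition half_width :: "real interval \<Rightarrow> real" where
  "half_width Q = (upper Q - lower Q) / 2"

definition prec_CW :: "real interval \<Rightarrow> real interval \<Rightarrow> bool" (infix "\<prec>CW" 50) where
  "Q \<prec>CW R \<longleftrightarrow> center Q < center R \<and> half_width Q < half_width R"

definition locally_lipschitz :: "(real^'n \<Rightarrow> real) \<Rightarrow> bool" where
  "locally_lipschitz \<psi> \<longleftrightarrow> (\<forall>z. \<exists>U L. open U \<and> z \<in> U \<and> L > 0 \<and>
     (\<forall>u1\<in>U. \<forall>u2\<in>U. \<bar>\<psi> u1 - \<psi> u2\<bar> \<le> L * norm (u1 - u2)))"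

definition ivl_locally_lipschitz :: "(real^'n \<Rightarrow> real interval) \<Rightarrow> bool" where
  "ivl_locally_lipschitz f \<longleftrightarrow> (\<forall>z. \<exists>U L. open U \<and> z \<in> U \<and> L > 0 \<and>
     (\<forall>u1\<in>U. \<forall>u2\<in>U. max \<bar>lower (f u1) - lower (f u2)\<bar> \<bar>upper (f u1) - upper (f u2)\<bar>
        \<le> L * norm (u1 - u2)))"

text \<open>The generalized directional derivative is taken in the extended reals, so that no junk value
  arises; it is finite for locally Lipschitz \<open>\<psi>\<close>.\<close>

definition clarke_deriv :: "(real^'n \<Rightarrow> real) \<Rightarrow> real^'n \<Rightarrow> real^'n \<Rightarrow> ereal" where
  "clarke_deriv \<psi> z w =
     Limsup (nhds z \<times>\<^sub>F at_right 0) (\<lambda>(u, t). ereal ((\<psi> (u + t *\<^sub>R w) - \<psi> u) / t))"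

definition clarke_grad :: "(real^'n \<Rightarrow> real) \<Rightarrow> real^'n \<Rightarrow> (real^'n) set" where
  "clarke_grad \<psi> z = {zs. \<forall>w. ereal (zs \<bullet> w) \<le> clarke_deriv \<psi> z w}"

definition ivl_clarke_grad :: "(real^'n \<Rightarrow> real interval) \<Rightarrow> real^'n \<Rightarrow> (real^'n) set" where
  "ivl_clarke_grad f u =
     convex hull (clarke_grad (\<lambda>x. center (f x)) u \<union> clarke_grad (\<lambda>x. half_width (f x)) u)"

text \<open>Players, criteria and constraints are indexed by \<open>{1..l}\<close>, \<open>{1..m}\<close> and \<open>{1..p}\<close>.  Vectors
  \<open>\<epsilon>\<close>, \<open>\<mu>\<close> over these index sets are functions on \<^typ>\<open>nat\<close> whose values outside the index set are
  never used.  The data \<open>g\<close> of \<open>strategy_set\<close>, \<open>active\<close> and \<open>BCQ\<close> belong to a single player.\<close>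

definition strategy_set :: "nat \<Rightarrow> (nat \<Rightarrow> real^'n \<Rightarrow> real) \<Rightarrow> (real^'n) set" where
  "strategy_set p g = {u. \<forall>j\<in>{1..p}. g j u \<le> 0}"

definition active :: "nat \<Rightarrow> (nat \<Rightarrow> real^'n \<Rightarrow> real) \<Rightarrow> real^'n \<Rightarrow> nat set" where
  "active p g x = {j\<in>{1..p}. g j x = 0}"

text \<open>Sums of sets below are Minkowski sums (the \<^class>\<open>comm_monoid_add\<close> structure on sets from
  \<^theory>\<open>HOL-Library.Set_Algebras\<close>), an empty sum being \<open>{0}\<close>.\<close>

definition BCQ :: "nat \<Rightarrow> (nat \<Rightarrow> real^'n \<Rightarrow> real) \<Rightarrow> real^'n \<Rightarrow> bool" where
  "BCQ p g x \<longleftrightarrow> \<not> (\<exists>\<mu>::nat \<Rightarrow> real.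
     (\<forall>j\<in>{1..p}. \<mu> j \<ge> 0) \<and> (\<exists>j\<in>{1..p}. \<mu> j \<noteq> 0) \<and>
     (\<forall>j\<in>{1..p} - active p g x. \<mu> j = 0) \<and>
     0 \<in> (\<Sum>j\<in>{1..p}. (*\<^sub>R) (\<mu> j) ` clarke_grad (g j) x))"

text \<open>A profile \<open>u\<close> is an extensional function on \<open>{1..l}\<close>; replacing the component of player \<open>i\<close>
  by \<open>y\<close> is the update \<open>u(i := y)\<close>.\<close>

definition weak_eps_nash ::
  "nat \<Rightarrow> nat \<Rightarrow> (nat \<Rightarrow> (real^'n) set) \<Rightarrow> (nat \<Rightarrow> nat \<Rightarrow> (nat \<Rightarrow> real^'n) \<Rightarrow> real interval)
    \<Rightarrow> (nat \<Rightarrow> real) \<Rightarrow> (nat \<Rightarrow> real^'n) \<Rightarrow> bool" where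
  "weak_eps_nash l m S F \<epsilon> u \<longleftrightarrow>
     u \<in> PiE {1..l} S \<and>
     (\<forall>i\<in>{1..l}. \<not> (\<exists>y\<in>S i. \<forall>k\<in>{1..m}. F i k (u(i := y)) + Interval (0, \<epsilon> k) \<prec>CW F i k u))"

end

(* For one player, a weak epsilon-equilibrium says that the maximum Phi over k of the shifted
   centers and half-widths of F_k (shifted so that its value at u_i is at most max epsilon_k / 2,
   the interval [0, epsilon_k] having center and half-width epsilon_k / 2) is nonnegative on S_i.
   Adding the penalty e |y - u_i| with e = max epsilon_k / (2 delta) gives a function whose minimum
   over S_i is attained at a point x with |x - u_i| <= delta.  No direction w makes
   all Clarke derivatives of the centers and half-widths at x smaller than -e |w| and those of the
   active constraints negative.  Separating 0 from the compact convex hull of the corresponding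
   gradients (the objective ones enlarged by the ball of radius e) yields Fritz John multipliers,
   and BCQ forbids the objective part from vanishing, so it can be normalised to 1. *)

theory Submission
  imports Defs
begin

section \<open>Clarke derivatives of locally Lipschitz functions\<close>

text \<open>Finite-dimensional Hahn-Banach: \<open>(v, q v - \<eta>)\<close> lies strictly below the
  epigraph of \<open>q\<close>, which is closed and convex, so a hyperplane separates the two. Since
  the epigraph is a cone, the normal \<open>(a, b)\<close> is nonnegative on it, and dividing by
  \<open>b > 0\<close> yields a linear minorant of \<open>q\<close> that is nearly exact at
  \<open>v\<close>.\<close>

lemma sublinear_support:
  fixes q :: "'a::euclidean_space \<Rightarrow> real"
  assumes add: "\<And>v w. q (v + w) \<le> q v + q w"
    and scale: "\<And>s w. s > 0 \<Longrightarrow> q (s *\<^sub>R w) = s * q w"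
    and "\<eta> > 0"
  obtains z where "\<And>w. z \<bullet> w \<le> q w" "q v - \<eta> < z \<bullet> v"
proof -
  have q0: "q 0 = 0" using scale[of 2 0] by simp
  have conv: "convex_on UNIV q"
  proof (rule convex_onI)
    show "q ((1 - t) *\<^sub>R x + t *\<^sub>R y) \<le> (1 - t) * q x + t * q y" if "0 < t" "t < 1" for t x y
      using add[of "(1 - t) *\<^sub>R x" "t *\<^sub>R y"] that by (simp add: scale)
  qed simp
  have "continuous_on UNIV q" using convex_on_continuous[OF open_UNIV conv] .
  then have "continuous_on UNIV (\<lambda>xy :: 'a \<times> real. q (fst xy))"
    by (rule continuous_on_compose2) (auto intro: continuous_intros)
  then have "closed (epigraph UNIV q)"
    by (simp add: epigraph_def closed_Collect_le continuous_on_snd)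
  moreover have "convex (epigraph UNIV q)" using conv by (rule convex_epigraphI)
  moreover have "(v, q v - \<eta>) \<notin> epigraph UNIV q" using \<open>\<eta> > 0\<close> by (simp add: mem_epigraph)
  ultimately obtain ab c where ab: "ab \<bullet> (v, q v - \<eta>) < c" "\<forall>y\<in>epigraph UNIV q. c < ab \<bullet> y"
    using separating_hyperplane_closed_point by metis
  obtain a b where [simp]: "ab = (a, b)" by (cases ab)
  have below: "a \<bullet> v + b * (q v - \<eta>) < c" using ab(1) by (simp add: inner_prod_def)
  have above: "c < a \<bullet> w + b * r" if "q w \<le> r" for w r
    using bspec[OF ab(2), of "(w, r)"] that by (simp add: mem_epigraph inner_prod_def)
  have "c < 0" using above[of 0 0] q0 by simp
  \<comment> \<open>A negative value could be scaled by a positive \<open>s\<close> to equal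
    \<open>c\<close> exactly, against the strict separation.\<close>
  have cone: "0 \<le> a \<bullet> w + b * q w" for w
  proof (rule ccontr)
    assume neg: "\<not> ?thesis"
    define s where "s = c / (a \<bullet> w + b * q w)"
    have "s > 0" using neg \<open>c < 0\<close> by (simp add: s_def divide_neg_neg)
    have "c < a \<bullet> (s *\<^sub>R w) + b * q (s *\<^sub>R w)" by (rule above) simp
    also have "\<dots> = s * (a \<bullet> w + b * q w)" using scale[OF \<open>s > 0\<close>] by (simp add: algebra_simps)
    also have "\<dots> = c" using neg by (simp add: s_def)
    finally show False by simp
  qed
  \<comment> \<open>The points \<open>(v, q v)\<close> and \<open>(v, q v - \<eta>)\<close> lie on
    opposite sides of the hyperplane, so it is not vertical.\<close>
  have "0 < b * \<eta>" using above[of v "q v"] below by (simp add: algebra_simps)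
  then have "b > 0" using \<open>\<eta> > 0\<close> by (simp add: zero_less_mult_iff)
  show thesis
  proof
    show "(- (1 / b) *\<^sub>R a) \<bullet> w \<le> q w" for w
      using cone[of w] \<open>b > 0\<close> by (simp add: field_simps)
    have "a \<bullet> v + b * (q v - \<eta>) < 0" using below \<open>c < 0\<close> by simp
    then show "q v - \<eta> < (- (1 / b) *\<^sub>R a) \<bullet> v" using \<open>b > 0\<close> by (simp add: field_simps)
  qed
qed

section \<open>Finiteness and sublinearity of the Clarke derivative\<close>

text \<open>The base point \<open>y\<close> may move as long as it tends to \<open>z\<close>;
  subadditivity relies on this freedom.\<close>

lemma clarke_deriv_less_eventually:
  assumes "clarke_deriv \<psi> z w < ereal c" "filterlim y (nhds z) F" "filterlim t (at_right 0) F"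
  shows "\<forall>\<^sub>F i in F. (\<psi> (y i + t i *\<^sub>R w) - \<psi> (y i)) / t i < c"
  using eventually_compose_filterlim[OF Limsup_lessD[OF assms(1)[unfolded clarke_deriv_def]]
      filterlim_Pair[OF assms(2,3)]]
  by simp

lemma clarke_deriv_le:
  assumes "\<forall>\<^sub>F (u, t) in nhds z \<times>\<^sub>F at_right 0. (\<psi> (u + t *\<^sub>R w) - \<psi> u) / t \<le> c"
  shows "clarke_deriv \<psi> z w \<le> ereal c"
  unfolding clarke_deriv_def using assms by (intro Limsup_bounded) (simp add: case_prod_unfold)

text \<open>Serves twice: the end point of a step stays in a Lipschitz neighbourhood of
  \<open>z\<close>, and it can itself be used as a moving base point.\<close>

lemma tendsto_step:
  fixes z w :: "'a::real_normed_vector"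
  shows "((\<lambda>x. fst x + snd x *\<^sub>R w) \<longlongrightarrow> z) (nhds z \<times>\<^sub>F at_right (0::real))"
proof -
  have "(fst \<longlongrightarrow> z) (nhds z \<times>\<^sub>F at_right (0::real))" by (rule filterlim_fst)
  moreover have "(snd \<longlongrightarrow> 0) (nhds z \<times>\<^sub>F at_right (0::real))"
    by (rule filterlim_mono[OF filterlim_snd _ order_refl]) (simp add: at_within_le_nhds)
  ultimately have "((\<lambda>x. fst x + snd x *\<^sub>R w) \<longlongrightarrow> z + 0 *\<^sub>R w) (nhds z \<times>\<^sub>F at_right (0::real))"
    by (intro tendsto_intros)
  then show ?thesis by simp
qed

lemma locally_lipschitz_clarke_deriv_bound:
  assumes "locally_lipschitz \<psi>"
  obtains L where "L > 0" "\<And>w. \<bar>clarke_deriv \<psi> z w\<bar> \<le> ereal (L * norm w)"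
proof -
  obtain U L where U: "open U" "z \<in> U" "L > 0"
    and lip: "\<And>u1 u2. u1 \<in> U \<Longrightarrow> u2 \<in> U \<Longrightarrow> \<bar>\<psi> u1 - \<psi> u2\<bar> \<le> L * norm (u1 - u2)"
    using assms unfolding locally_lipschitz_def by meson
  have "\<bar>clarke_deriv \<psi> z w\<bar> \<le> ereal (L * norm w)" for w
  proof -
    let ?F = "nhds z \<times>\<^sub>F at_right (0::real)"
    have "\<forall>\<^sub>F u in nhds z. u \<in> U" using U eventually_nhds by blast
    then have "\<forall>\<^sub>F x in ?F. fst x \<in> U" "\<forall>\<^sub>F x in ?F. fst x + snd x *\<^sub>R w \<in> U"
      using eventually_compose_filterlim[OF _ filterlim_fst]
        eventually_compose_filterlim[OF _ tendsto_step[of w z]]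
      by auto
    moreover have "\<forall>\<^sub>F x in ?F. snd x > 0"
      using eventually_compose_filterlim[OF eventually_at_right_less filterlim_snd] .
    ultimately have ev: "\<forall>\<^sub>F x in ?F. \<bar>(\<psi> (fst x + snd x *\<^sub>R w) - \<psi> (fst x)) / snd x\<bar> \<le> L * norm w"
    proof eventually_elim
      case (elim x)
      show ?case using lip[OF elim(2,1)] elim(3) by (simp add: field_simps)
    qed
    have "clarke_deriv \<psi> z w \<le> ereal (L * norm w)"
      by (rule clarke_deriv_le) (use ev in eventually_elim, auto simp: abs_le_iff simp del: abs_divide)
    \<comment> \<open>An eventual lower bound passes to the limsup along a proper filter, which is
      the first subgoal.\<close>
    moreover have "ereal (- (L * norm w)) \<le> clarke_deriv \<psi> z w"
      unfolding clarke_deriv_def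
      by (rule le_Limsup, simp add: prod_filter_eq_bot)
        (use ev in eventually_elim, auto simp: abs_le_iff simp del: abs_divide)
    ultimately show ?thesis by (cases "clarke_deriv \<psi> z w") auto
  qed
  with \<open>L > 0\<close> that show thesis by blast
qed

text \<open>The quotient in direction \<open>v + w\<close> at \<open>u\<close> is the quotient in
  direction \<open>v\<close> at \<open>u\<close> plus the one in direction \<open>w\<close> at
  \<open>u + t v\<close>, and both base points tend to \<open>z\<close>. Each quotient is eventually
  within \<open>\<eta> / 2\<close> of its upper limit from above.\<close>

lemma clarke_deriv_add:
  assumes "locally_lipschitz \<psi>"
  shows "clarke_deriv \<psi> z (v + w) \<le> clarke_deriv \<psi> z v + clarke_deriv \<psi> z w"
proof -
  obtain L where L: "\<And>w. \<bar>clarke_deriv \<psi> z w\<bar> \<le> ereal (L * norm w)"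
    using locally_lipschitz_clarke_deriv_bound[OF assms] by metis
  obtain a b where ab: "clarke_deriv \<psi> z v = ereal a" "clarke_deriv \<psi> z w = ereal b"
    using L[of v] L[of w] by (cases "clarke_deriv \<psi> z v"; cases "clarke_deriv \<psi> z w") auto
  have "clarke_deriv \<psi> z (v + w) \<le> ereal (a + b) + ereal \<eta>" if "\<eta> > 0" for \<eta>
  proof -
    let ?F = "nhds z \<times>\<^sub>F at_right (0::real)"
    have "\<forall>\<^sub>F x in ?F. (\<psi> (fst x + snd x *\<^sub>R v) - \<psi> (fst x)) / snd x < a + \<eta> / 2"
      by (intro clarke_deriv_less_eventually[where z = z] filterlim_fst filterlim_snd) (use ab that in auto)
    moreover have "\<forall>\<^sub>F x in ?F. (\<psi> (fst x + snd x *\<^sub>R v + snd x *\<^sub>R w) -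
        \<psi> (fst x + snd x *\<^sub>R v)) / snd x < b + \<eta> / 2"
      by (intro clarke_deriv_less_eventually[where z = z] filterlim_snd tendsto_step) (use ab that in auto)
    ultimately have "clarke_deriv \<psi> z (v + w) \<le> ereal (a + b + \<eta>)"
    proof (intro clarke_deriv_le, eventually_elim, clarsimp)
      fix u t
      assume "(\<psi> (u + t *\<^sub>R v) - \<psi> u) / t < a + \<eta> / 2"
        "(\<psi> (u + t *\<^sub>R v + t *\<^sub>R w) - \<psi> (u + t *\<^sub>R v)) / t < b + \<eta> / 2"
      then show "(\<psi> (u + t *\<^sub>R (v + w)) - \<psi> u) / t \<le> a + b + \<eta>"
        by (simp add: scaleR_add_right add.assoc diff_divide_distrib)
    qed
    then show ?thesis by simp
  qed
  then have "clarke_deriv \<psi> z (v + w) \<le> ereal (a + b)"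
    by (rule ereal_le_epsilon2)
  with ab show ?thesis by simp
qed

text \<open>A step \<open>t\<close> in direction \<open>s w\<close> is a step \<open>t * s\<close>
  in direction \<open>w\<close>. The reverse inequality will follow by applying this one with factor
  \<open>1 / s\<close>.\<close>

lemma clarke_deriv_scale_le:
  assumes "s > 0" "clarke_deriv \<psi> z w \<le> ereal a"
  shows "clarke_deriv \<psi> z (s *\<^sub>R w) \<le> ereal (s * a)"
proof (rule ereal_le_epsilon2)
  fix \<eta> :: real assume "\<eta> > 0"
  let ?F = "nhds z \<times>\<^sub>F at_right (0::real)"
  have "filterlim (\<lambda>t. t * s) (at_right 0) (at_right (0::real))"
    unfolding filterlim_at using \<open>s > 0\<close>
    by (auto intro!: tendsto_eq_intros simp: eventually_at_filter)
  from filterlim_compose[OF this filterlim_snd]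
  have "\<forall>\<^sub>F x in ?F. (\<psi> (fst x + (snd x * s) *\<^sub>R w) - \<psi> (fst x)) / (snd x * s) < a + \<eta> / s"
    using assms \<open>\<eta> > 0\<close>
    by (intro clarke_deriv_less_eventually[where z = z] filterlim_fst) (simp_all add: order_le_less_trans)
  then have "clarke_deriv \<psi> z (s *\<^sub>R w) \<le> ereal (s * a + \<eta>)"
  proof (intro clarke_deriv_le, eventually_elim, clarsimp)
    fix u t assume "(\<psi> (u + (t * s) *\<^sub>R w) - \<psi> u) / (t * s) < a + \<eta> / s"
    then have "s * ((\<psi> (u + (t * s) *\<^sub>R w) - \<psi> u) / (t * s)) \<le> s * (a + \<eta> / s)"
      using \<open>s > 0\<close> by (intro mult_left_mono) auto
    then show "(\<psi> (u + (t * s) *\<^sub>R w) - \<psi> u) / t \<le> s * a + \<eta>"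
      using \<open>s > 0\<close> by (simp add: distrib_left)
  qed
  then show "clarke_deriv \<psi> z (s *\<^sub>R w) \<le> ereal (s * a) + ereal \<eta>" by simp
qed

text \<open>Passes from extended reals to a real sublinear functional \<open>q\<close>, the form
  that \<open>sublinear_support\<close> accepts.\<close>

lemma clarke_deriv_real:
  assumes "locally_lipschitz \<psi>"
  obtains q L where "\<And>w. clarke_deriv \<psi> z w = ereal (q w)"
    "\<And>v w. q (v + w) \<le> q v + q w" "\<And>s w. s > 0 \<Longrightarrow> q (s *\<^sub>R w) = s * q w"
    "L > 0" "\<And>w. \<bar>q w\<bar> \<le> L * norm w"
proof -
  obtain L where L: "L > 0" "\<And>w. \<bar>clarke_deriv \<psi> z w\<bar> \<le> ereal (L * norm w)"
    using locally_lipschitz_clarke_deriv_bound[OF assms] by metis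
  define q where "q w = real_of_ereal (clarke_deriv \<psi> z w)" for w
  have q: "clarke_deriv \<psi> z w = ereal (q w)" for w
    using L(2)[of w] unfolding q_def by (cases "clarke_deriv \<psi> z w") auto
  have le: "q (s *\<^sub>R w) \<le> s * q w" if "s > 0" for s w
    using clarke_deriv_scale_le[OF that, of \<psi> z w "q w"] by (simp add: q)
  show thesis
  proof
    show "clarke_deriv \<psi> z w = ereal (q w)" for w by (fact q)
    show "q (v + w) \<le> q v + q w" for v w using clarke_deriv_add[OF assms, of z v w] by (simp add: q)
    show "q (s *\<^sub>R w) = s * q w" if "s > 0" for s w
    proof (rule antisym)
      show "s * q w \<le> q (s *\<^sub>R w)"
        using le[of "1 / s" "s *\<^sub>R w"] that by (simp add: field_simps)
    qed (use le that in auto)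
    show "L > 0" by (fact L)
    show "\<bar>q w\<bar> \<le> L * norm w" for w using L(2)[of w] by (simp add: q)
  qed
qed

section \<open>Duality between Clarke derivative and Clarke gradient\<close>

text \<open>The gradient consists of the linear minorants of \<open>q\<close>, so
  \<open>sublinear_support\<close> with slack \<open>q w - c\<close> supplies the element.\<close>

lemma clarke_grad_support:
  assumes "locally_lipschitz \<psi>" "ereal c < clarke_deriv \<psi> z w"
  obtains v where "v \<in> clarke_grad \<psi> z" "c < v \<bullet> w"
proof -
  obtain q L where q: "\<And>w. clarke_deriv \<psi> z w = ereal (q w)"
    "\<And>v w. q (v + w) \<le> q v + q w" "\<And>s w. s > 0 \<Longrightarrow> q (s *\<^sub>R w) = s * q w"
    using clarke_deriv_real[OF assms(1), of z] by metis
  have "q w - c > 0" using assms(2) by (simp add: q)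
  from sublinear_support[OF q(2,3) this, of w] obtain v where "\<And>w. v \<bullet> w \<le> q w" "c < v \<bullet> w"
    by auto
  then show thesis using that by (auto simp: clarke_grad_def q)
qed

text \<open>The contrapositive of \<open>clarke_grad_support\<close>: a bound on the gradient coming
  from a separating hyperplane becomes a bound on the derivative.\<close>

lemma clarke_deriv_le_support:
  assumes "locally_lipschitz \<psi>" "\<And>v. v \<in> clarke_grad \<psi> z \<Longrightarrow> v \<bullet> w \<le> c"
  shows "clarke_deriv \<psi> z w \<le> ereal c"
proof (rule leI, rule notI)
  assume "ereal c < clarke_deriv \<psi> z w"
  then obtain v where "v \<in> clarke_grad \<psi> z" "c < v \<bullet> w"
    using clarke_grad_support[OF assms(1)] by blast
  with assms(2)[of v] show False by simp
qed

lemma clarke_grad_nonempty: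
  assumes "locally_lipschitz \<psi>"
  shows "clarke_grad \<psi> z \<noteq> {}"
proof -
  obtain q where "clarke_deriv \<psi> z 0 = ereal (q (0::real^'a))"
    using clarke_deriv_real[OF assms, of z] by metis
  then have "ereal (q 0 - 1) < clarke_deriv \<psi> z 0" by simp
  with clarke_grad_support[OF assms] show ?thesis by blast
qed

text \<open>The gradient is an intersection of closed half-spaces; testing an element
  \<open>v\<close> in its own direction bounds its norm by \<open>L\<close>.\<close>

lemma clarke_grad_compact_convex:
  assumes "locally_lipschitz \<psi>"
  shows "compact (clarke_grad \<psi> z)" "convex (clarke_grad \<psi> z)"
proof -
  obtain q L where q: "\<And>w. clarke_deriv \<psi> z w = ereal (q w)"
    and L: "L > 0" "\<And>w. \<bar>q w\<bar> \<le> L * norm w"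
    using clarke_deriv_real[OF assms, of z] by metis
  have eq: "clarke_grad \<psi> z = (\<Inter>w. {v. w \<bullet> v \<le> q w})"
    by (auto simp: clarke_grad_def q inner_commute)
  show "convex (clarke_grad \<psi> z)"
    unfolding eq by (intro convex_INT convex_halfspace_le)
  have "norm v \<le> L" if "v \<in> clarke_grad \<psi> z" for v
  proof -
    have "v \<bullet> v \<le> q v" using that by (simp add: clarke_grad_def q)
    also have "\<dots> \<le> L * norm v" using L(2)[of v] by simp
    finally have "norm v * norm v \<le> L * norm v" by (simp add: dot_square_norm power2_eq_square)
    then show ?thesis using L(1) by (cases "v = 0") auto
  qed
  then have "bounded (clarke_grad \<psi> z)" by (auto simp: bounded_iff)
  moreover have "closed (clarke_grad \<psi> z)"
    unfolding eq by (intro closed_INT ballI closed_halfspace_le)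
  ultimately show "compact (clarke_grad \<psi> z)" by (simp add: compact_eq_bounded_closed)
qed

text \<open>Keeping the base point fixed at \<open>x\<close> shows that the Clarke derivative
  controls ordinary one-sided quotients.\<close>

lemma clarke_deriv_less_descent:
  assumes "clarke_deriv \<psi> x w < ereal c"
  shows "\<forall>\<^sub>F t in at_right 0. \<psi> (x + t *\<^sub>R w) < \<psi> x + c * t"
proof -
  have "\<forall>\<^sub>F t in at_right 0. (\<psi> (x + t *\<^sub>R w) - \<psi> x) / t < c"
    using clarke_deriv_less_eventually[OF assms tendsto_const filterlim_ident] .
  with eventually_at_right_less[of 0] show ?thesis
    by eventually_elim (auto simp: field_simps)
qed

lemma locally_lipschitz_continuous:
  assumes "locally_lipschitz \<psi>"
  shows "continuous_on UNIV \<psi>"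
proof -
  have "isCont \<psi> z" for z
  proof -
    obtain U L where U: "open U" "z \<in> U" "L > 0"
      and lip: "\<And>u1 u2. u1 \<in> U \<Longrightarrow> u2 \<in> U \<Longrightarrow> \<bar>\<psi> u1 - \<psi> u2\<bar> \<le> L * norm (u1 - u2)"
      using assms unfolding locally_lipschitz_def by meson
    have "L-lipschitz_on U \<psi>"
      using U(3) lip by (intro lipschitz_onI) (auto simp: dist_norm)
    then show ?thesis
      using lipschitz_on_continuous_on U continuous_on_eq_continuous_at by blast
  qed
  then show ?thesis by (simp add: continuous_at_imp_continuous_on)
qed

section \<open>Weak minimality and multipliers\<close>

lemma continuous_on_Max_image:
  fixes f :: "'a \<Rightarrow> 'b::topological_space \<Rightarrow> 'c::linorder_topology"
  assumes "finite A" "A \<noteq> {}" "\<And>a. a \<in> A \<Longrightarrow> continuous_on T (f a)"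
  shows "continuous_on T (\<lambda>y. Max ((\<lambda>a. f a y) ` A))"
  using assms
proof (induction rule: finite_ne_induct)
  case (insert a A)
  then show ?case by (simp add: continuous_on_max)
qed simp

text \<open>This replaces Ekeland's principle: the penalty is the distance to \<open>x0\<close>, whose growth makes
  the penalised function attain its minimum inside the ball.\<close>

lemma penalized_minimizer:
  fixes x0 :: "'a::heine_borel"
  assumes "closed S" "x0 \<in> S" "continuous_on S \<phi>" "\<And>y. y \<in> S \<Longrightarrow> 0 \<le> \<phi> y"
    and "\<phi> x0 \<le> e * \<delta>" "e > 0" "\<delta> \<ge> 0"
  obtains x where "x \<in> S" "dist x x0 \<le> \<delta>" "\<And>y. y \<in> S \<Longrightarrow> \<phi> x \<le> \<phi> y + e * dist y x"
proof -
  let ?f = "\<lambda>y. \<phi> y + e * dist y x0"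
  have "compact (S \<inter> cball x0 \<delta>)" using assms(1) by (simp add: closed_Int_compact)
  moreover have "x0 \<in> S \<inter> cball x0 \<delta>" using assms by simp
  moreover have "continuous_on (S \<inter> cball x0 \<delta>) ?f"
    by (intro continuous_intros continuous_on_subset[OF assms(3)]) auto
  ultimately obtain x where x: "x \<in> S \<inter> cball x0 \<delta>"
    and min: "\<And>y. y \<in> S \<inter> cball x0 \<delta> \<Longrightarrow> ?f x \<le> ?f y"
    using continuous_attains_inf[of "S \<inter> cball x0 \<delta>" ?f] by blast
  \<comment> \<open>The minimum over the ball is one over all of \<open>S\<close>: outside the ball
    the penalty alone is at least \<open>e * \<delta>\<close>, hence at least the value of
    \<open>?f\<close> at \<open>x0\<close>.\<close>
  have "?f x \<le> ?f y" if "y \<in> S" for y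
  proof (cases "y \<in> cball x0 \<delta>")
    case False
    then have "e * \<delta> \<le> e * dist y x0" using \<open>e > 0\<close> by (simp add: dist_commute)
    then show ?thesis using min[of x0] assms(2,4,5,7) that by force
  qed (use min that in auto)
  \<comment> \<open>The triangle inequality moves the centre of the penalty from \<open>x0\<close>
    to \<open>x\<close>.\<close>
  moreover have "e * dist y x0 \<le> e * dist x x0 + e * dist y x" for y
    using dist_triangle[of y x0 x] \<open>e > 0\<close> by (simp flip: distrib_left)
  ultimately have "\<phi> x \<le> \<phi> y + e * dist y x" if "y \<in> S" for y
    using that by (smt (verit))
  with x that show thesis by (auto simp: dist_commute)
qed

section \<open>First-order conditions at a weak minimiser\<close>

text \<open>Otherwise a short step along \<open>w\<close> stays feasible and lowers every
  \<open>h a\<close> by more than \<open>e\<close> times its length, contradicting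
  \<open>opt\<close>.\<close>

lemma no_common_descent:
  fixes h :: "'a \<Rightarrow> real^'n \<Rightarrow> real" and g :: "'b \<Rightarrow> real^'n \<Rightarrow> real"
  assumes fin: "finite A" "finite J"
    and cont: "\<And>j. j \<in> J \<Longrightarrow> continuous_on UNIV (g j)"
    and feas: "\<And>j. j \<in> J \<Longrightarrow> g j x \<le> 0"
    and opt: "\<And>y. \<forall>j\<in>J. g j y \<le> 0 \<Longrightarrow> \<exists>a\<in>A. h a x \<le> h a y + e * dist y x"
  shows "(\<exists>a\<in>A. ereal (- e * norm w) \<le> clarke_deriv (h a) x w) \<or>
    (\<exists>j\<in>J. g j x = 0 \<and> 0 \<le> clarke_deriv (g j) x w)"
proof (rule ccontr)
  assume neg: "\<not> ?thesis"
  have "\<forall>\<^sub>F t in at_right 0. \<forall>a\<in>A. h a (x + t *\<^sub>R w) < h a x + (- e * norm w) * t"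
    using neg by (intro eventually_ball_finite[OF fin(1)] ballI clarke_deriv_less_descent) auto
  moreover have "\<forall>\<^sub>F t in at_right 0. \<forall>j\<in>J. g j (x + t *\<^sub>R w) \<le> 0"
  proof (intro eventually_ball_finite[OF fin(2)] ballI)
    fix j assume j: "j \<in> J"
    show "\<forall>\<^sub>F t in at_right 0. g j (x + t *\<^sub>R w) \<le> 0"
    proof (cases "g j x = 0")
      case True
      then have "clarke_deriv (g j) x w < ereal 0" using neg j by (auto simp: zero_ereal_def)
      from clarke_deriv_less_descent[OF this] show ?thesis
        by eventually_elim (use True in simp)
    next
      case False
      \<comment> \<open>An inactive constraint is negative at \<open>x\<close> and stays so nearby
        by continuity.\<close>
      have "isCont (g j) x" using cont[OF j] by (simp add: continuous_on_eq_continuous_at)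
      moreover have "((\<lambda>t. x + t *\<^sub>R w) \<longlongrightarrow> x) (at_right 0)"
        by (auto intro!: tendsto_eq_intros)
      ultimately have "((\<lambda>t. g j (x + t *\<^sub>R w)) \<longlongrightarrow> g j x) (at_right 0)"
        by (rule isCont_tendsto_compose)
      moreover have "g j x < 0" using False feas[OF j] by simp
      ultimately show ?thesis
        using order_tendstoD(2) by (fastforce elim: eventually_mono)
    qed
  qed
  ultimately have "\<forall>\<^sub>F t in at_right 0. (\<forall>a\<in>A. h a (x + t *\<^sub>R w) < h a x + (- e * norm w) * t) \<and>
      (\<forall>j\<in>J. g j (x + t *\<^sub>R w) \<le> 0) \<and> t > (0::real)"
    using eventually_at_right_less[of "0::real"] by eventually_elim auto
  then obtain t where "t > 0" "\<forall>a\<in>A. h a (x + t *\<^sub>R w) < h a x + (- e * norm w) * t"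
    "\<forall>j\<in>J. g j (x + t *\<^sub>R w) \<le> 0"
    using eventually_happens'[OF trivial_limit_at_right_real] by blast
  with opt[of "x + t *\<^sub>R w"] show False by (force simp: dist_norm mult_ac)
qed

text \<open>If 0 were outside, strict separation would give \<open>w\<close> whose inner product
  with every element of \<open>?C\<close> exceeds some \<open>c > 0\<close>; then \<open>- w\<close>
  is a direction excluded by \<open>no_common_descent\<close>. The added ball accounts for the slope
  \<open>e\<close> of the penalty.\<close>

lemma zero_in_hull_clarke_grads:
  fixes h :: "'a \<Rightarrow> real^'n \<Rightarrow> real" and g :: "'b \<Rightarrow> real^'n \<Rightarrow> real"
  assumes fin: "finite A" "finite J"
    and lip_h: "\<And>a. a \<in> A \<Longrightarrow> locally_lipschitz (h a)"
    and lip_g: "\<And>j. j \<in> J \<Longrightarrow> locally_lipschitz (g j)"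
    and feas: "\<And>j. j \<in> J \<Longrightarrow> g j x \<le> 0"
    and opt: "\<And>y. \<forall>j\<in>J. g j y \<le> 0 \<Longrightarrow> \<exists>a\<in>A. h a x \<le> h a y + e * dist y x"
    and "e \<ge> 0"
  shows "0 \<in> convex hull ((\<Union>a\<in>A. clarke_grad (h a) x + cball 0 e) \<union>
    (\<Union>j\<in>{j\<in>J. g j x = 0}. clarke_grad (g j) x))" (is "0 \<in> convex hull ?C")
proof (rule ccontr)
  assume notin: "0 \<notin> convex hull ?C"
  \<comment> \<open>Compactness of the finitely many pieces makes the hull closed, as strict
    separation requires.\<close>
  have "compact (clarke_grad (h a) x + cball 0 e)" if "a \<in> A" for a
  proof -
    have "clarke_grad (h a) x + cball 0 e = (\<Union>v\<in>clarke_grad (h a) x. \<Union>b\<in>cball 0 e. {v + b})"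
      by (auto simp: set_plus_def)
    then show ?thesis
      using compact_sums'[OF clarke_grad_compact_convex(1)[OF lip_h[OF that]] compact_cball] by simp
  qed
  then have "compact ?C"
    using fin lip_g by (intro compact_Un compact_UN) (auto intro: clarke_grad_compact_convex)
  then have "closed (convex hull ?C)" by (intro compact_imp_closed compact_convex_hull)
  from separating_hyperplane_closed_point[OF convex_convex_hull this notin]
  obtain w c where "w \<bullet> 0 < c" and sep_hull: "\<forall>v\<in>convex hull ?C. c < w \<bullet> v"
    by blast
  then have "c > 0" by simp
  have sep: "c < w \<bullet> v" if "v \<in> ?C" for v
    by (rule bspec[OF sep_hull hull_inc[OF that]])
  have grad_h: "clarke_deriv (h a) x (- w) < ereal (- e * norm (- w))" if "a \<in> A" for a
  proof -
    \<comment> \<open>The point of the ball with the least inner product with \<open>w\<close>; for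
      \<open>w = 0\<close> it is 0.\<close>
    define b where "b = - e *\<^sub>R (w /\<^sub>R norm w)"
    have wb: "w \<bullet> b = - e * norm w"
      by (cases "w = 0") (simp_all add: b_def dot_square_norm power2_eq_square)
    have b: "b \<in> cball 0 e"
      using \<open>e \<ge> 0\<close> by (cases "w = 0") (simp_all add: b_def mult.assoc)
    have sep_a: "v \<bullet> (- w) < - c - e * norm w" if "v \<in> clarke_grad (h a) x" for v
    proof -
      have "v + b \<in> ?C" by (rule UnI1, rule UN_I[OF \<open>a \<in> A\<close>], rule set_plus_intro[OF that b])
      from sep[OF this] show ?thesis using wb by (simp add: inner_add_right inner_commute)
    qed
    have "clarke_deriv (h a) x (- w) \<le> ereal (- c - e * norm w)"
      using sep_a by (intro clarke_deriv_le_support lip_h \<open>a \<in> A\<close>) (simp add: less_imp_le)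
    also have "\<dots> < ereal (- e * norm (- w))" using \<open>c > 0\<close> by simp
    finally show ?thesis .
  qed
  have grad_g: "clarke_deriv (g j) x (- w) < 0" if "j \<in> J" "g j x = 0" for j
  proof -
    have "v \<bullet> (- w) < - c" if v: "v \<in> clarke_grad (g j) x" for v
    proof -
      have "v \<in> ?C" using v \<open>j \<in> J\<close> \<open>g j x = 0\<close> by blast
      from sep[OF this] show ?thesis by (simp add: inner_commute)
    qed
    then have "clarke_deriv (g j) x (- w) \<le> ereal (- c)"
      by (intro clarke_deriv_le_support lip_g \<open>j \<in> J\<close>) (simp add: less_imp_le)
    also have "\<dots> < 0" using \<open>c > 0\<close> by simp
    finally show ?thesis .
  qed
  show False
    using no_common_descent[OF fin locally_lipschitz_continuous[OF lip_g] feas opt, where w = "- w"]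
      grad_h grad_g by fastforce
qed

section \<open>From the convex hull to normalised multipliers\<close>

lemma norm_combination_le:
  fixes b :: "'a \<Rightarrow> 'b::real_normed_vector"
  assumes "\<And>i. i \<in> I \<Longrightarrow> c i \<ge> 0 \<and> norm (b i) \<le> r"
  shows "norm (\<Sum>i\<in>I. c i *\<^sub>R b i) \<le> sum c I * r"
  by (rule order_trans[OF norm_sum])
    (use assms in \<open>auto simp: sum_distrib_right intro!: sum_mono mult_left_mono\<close>)

text \<open>Every piece is convex, so one point from each suffices. The disjoint sum
  \<open>K <+> J\<close> turns the two families into one.\<close>

lemma convex_hull_two_families:
  assumes fin: "finite K" "finite J"
    and G: "\<And>k. k \<in> K \<Longrightarrow> convex (G k) \<and> G k \<noteq> {}"
    and H: "\<And>j. j \<in> J \<Longrightarrow> convex (H j) \<and> H j \<noteq> {}"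
    and z: "z \<in> convex hull ((\<Union>k\<in>K. G k) \<union> (\<Union>j\<in>J. H j))"
  obtains c d x y where "\<And>k. k \<in> K \<Longrightarrow> c k \<ge> 0 \<and> x k \<in> G k" "\<And>j. j \<in> J \<Longrightarrow> d j \<ge> 0 \<and> y j \<in> H j"
    "sum c K + sum d J = 1" "z = (\<Sum>k\<in>K. c k *\<^sub>R x k) + (\<Sum>j\<in>J. d j *\<^sub>R y j)"
proof -
  have eq: "(\<Union>k\<in>K. G k) \<union> (\<Union>j\<in>J. H j) = \<Union> (case_sum G H ` (K <+> J))" by auto
  have "z \<in> {sum (\<lambda>i. c i *\<^sub>R s i) (K <+> J) |c s. (\<forall>i\<in>K <+> J. c i \<ge> 0) \<and> sum c (K <+> J) = 1 \<and>
      (\<forall>i\<in>K <+> J. s i \<in> case_sum G H i)}"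
    using z unfolding eq
    by (subst (asm) convex_hull_finite_union) (use fin G H in auto)
  then obtain c s where cs: "z = sum (\<lambda>i. c i *\<^sub>R s i) (K <+> J)" "\<forall>i\<in>K <+> J. c i \<ge> 0"
    "sum c (K <+> J) = 1" "\<forall>i\<in>K <+> J. s i \<in> case_sum G H i"
    by auto
  show thesis
    by (rule that[of "c \<circ> Inl" "s \<circ> Inl" "c \<circ> Inr" "s \<circ> Inr"])
      (use cs fin in \<open>force simp: sum.Plus\<close>)+
qed

text \<open>If the objective weights all vanished, the constraint weights, of total 1, would
  represent 0 and violate \<open>BCQ\<close>. So their sum is positive and all weights can be
  divided by it.\<close>

lemma normalized_multipliers:
  fixes G :: "'a \<Rightarrow> (real^'n) set" and g :: "nat \<Rightarrow> real^'n \<Rightarrow> real"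
  assumes fin: "finite K"
    and G: "\<And>k. k \<in> K \<Longrightarrow> convex (G k) \<and> G k \<noteq> {}"
    and lip_g: "\<And>j. j \<in> {1..p} \<Longrightarrow> locally_lipschitz (g j)"
    and bcq: "BCQ p g x"
    and zero: "0 \<in> convex hull ((\<Union>k\<in>K. G k + cball 0 e) \<union> (\<Union>j\<in>active p g x. clarke_grad (g j) x))"
    and "e \<ge> 0"
  shows "\<exists>lam \<mu>. (\<forall>k\<in>K. lam k \<ge> 0) \<and> sum lam K = 1 \<and> (\<forall>j. \<mu> j \<ge> (0::real)) \<and>
    (\<forall>j. j \<notin> active p g x \<longrightarrow> \<mu> j = 0) \<and>
    0 \<in> (\<Sum>k\<in>K. (*\<^sub>R) (lam k) ` G k) +
      (\<Sum>j\<in>active p g x. (*\<^sub>R) (\<mu> j) ` clarke_grad (g j) x) + cball 0 e"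
proof -
  let ?J = "active p g x"
  have J: "finite ?J" "?J \<subseteq> {1..p}" by (auto simp: active_def)
  have GB: "convex (G k + cball 0 e) \<and> G k + cball 0 e \<noteq> {}" if "k \<in> K" for k
    using G[OF that] \<open>e \<ge> 0\<close> set_plus_intro[of _ "G k" 0 "cball 0 e"]
    by (auto intro: convex_set_plus)
  have H: "convex (clarke_grad (g j) x) \<and> clarke_grad (g j) x \<noteq> {}" if "j \<in> {1..p}" for j
    using lip_g[OF that] clarke_grad_compact_convex(2) clarke_grad_nonempty by blast
  obtain c d s y where s: "\<And>k. k \<in> K \<Longrightarrow> c k \<ge> 0 \<and> s k \<in> G k + cball 0 e"
    and y: "\<And>j. j \<in> ?J \<Longrightarrow> d j \<ge> 0 \<and> y j \<in> clarke_grad (g j) x"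
    and one: "sum c K + sum d ?J = 1"
    and sum0: "0 = (\<Sum>k\<in>K. c k *\<^sub>R s k) + (\<Sum>j\<in>?J. d j *\<^sub>R y j)"
    by (rule convex_hull_two_families[OF fin J(1) GB _ zero]) (use H J(2) in auto)
  have "\<forall>k\<in>K. \<exists>a b. s k = a + b \<and> a \<in> G k \<and> norm b \<le> e"
  proof
    fix k assume "k \<in> K"
    then have "s k \<in> G k + cball 0 e" using s by simp
    then show "\<exists>a b. s k = a + b \<and> a \<in> G k \<and> norm b \<le> e"
      by (rule set_plus_elim) auto
  qed
  then obtain a b where ab: "\<And>k. k \<in> K \<Longrightarrow> s k = a k + b k \<and> a k \<in> G k \<and> norm (b k) \<le> e"
    by metis
  have pos: "sum c K > 0"
  proof (rule ccontr)
    assume "\<not> ?thesis"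
    then have "sum c K = 0" using sum_nonneg[of K c] s by force
    then have c0: "\<And>k. k \<in> K \<Longrightarrow> c k = 0" using sum_nonneg_eq_0_iff[of K c] fin s by blast
    define \<nu> where "\<nu> j = (if j \<in> ?J then d j else 0)" for j
    \<comment> \<open>\<open>BCQ\<close> sums over all of \<open>{1..p}\<close>, so inactive indices
      get coefficient 0 and an arbitrary gradient element, which exists by \<open>H\<close>.\<close>
    define y' where "y' j = (if j \<in> ?J then y j else (SOME v. v \<in> clarke_grad (g j) x))" for j
    have y': "y' j \<in> clarke_grad (g j) x" if "j \<in> {1..p}" for j
      using y H[OF that] by (auto simp: y'_def some_in_eq)
    have "(\<Sum>j\<in>{1..p}. \<nu> j *\<^sub>R y' j) = (\<Sum>j\<in>?J. d j *\<^sub>R y j)"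
      using J by (intro sum.mono_neutral_cong_right) (auto simp: \<nu>_def y'_def)
    also have "\<dots> = 0" using sum0 c0 by simp
    finally have "0 \<in> (\<Sum>j\<in>{1..p}. (*\<^sub>R) (\<nu> j) ` clarke_grad (g j) x)"
      using y' by (subst set_sum_alt) (auto intro!: exI[of _ "\<lambda>j. \<nu> j *\<^sub>R y' j"])
    moreover obtain j where "j \<in> ?J" "d j \<noteq> 0" using one \<open>sum c K = 0\<close> by (metis add_0 sum.neutral zero_neq_one)
    then have "\<exists>j\<in>{1..p}. \<nu> j \<noteq> 0" using J(2) by (auto simp: \<nu>_def)
    moreover have "\<forall>j\<in>{1..p}. \<nu> j \<ge> 0" using y by (simp add: \<nu>_def)
    moreover have "\<forall>j\<in>{1..p} - ?J. \<nu> j = 0" by (simp add: \<nu>_def)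
    ultimately show False using bcq unfolding BCQ_def by blast
  qed
  define lam where "lam k = c k / sum c K" for k
  define \<mu> where "\<mu> j = (if j \<in> ?J then d j / sum c K else 0)" for j
  \<comment> \<open>The ball parts of all objective terms, merged; the weights \<open>lam\<close>
    sum to 1, so the radius stays \<open>e\<close>.\<close>
  define r where "r = (\<Sum>k\<in>K. lam k *\<^sub>R b k)"
  have lam: "lam k \<ge> 0" if "k \<in> K" for k using s[OF that] pos by (simp add: lam_def)
  have lam1: "sum lam K = 1" using pos by (simp add: lam_def flip: sum_divide_distrib)
  have "norm r \<le> sum lam K * e"
    unfolding r_def by (rule norm_combination_le) (use lam ab in auto)
  then have r: "r \<in> cball 0 e" using lam1 by simp
  have "(1 / sum c K) *\<^sub>R ((\<Sum>k\<in>K. c k *\<^sub>R s k) + (\<Sum>j\<in>?J. d j *\<^sub>R y j)) =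
      (\<Sum>k\<in>K. lam k *\<^sub>R s k) + (\<Sum>j\<in>?J. \<mu> j *\<^sub>R y j)"
    by (simp add: scaleR_add_right scaleR_sum_right lam_def \<mu>_def)
  also have "(\<Sum>k\<in>K. lam k *\<^sub>R s k) = (\<Sum>k\<in>K. lam k *\<^sub>R a k) + r"
    unfolding r_def using ab by (simp add: scaleR_add_right flip: sum.distrib)
  finally have eq0: "0 = (\<Sum>k\<in>K. lam k *\<^sub>R a k) + (\<Sum>j\<in>?J. \<mu> j *\<^sub>R y j) + r"
    using sum0 by (simp add: algebra_simps)
  have "(\<Sum>k\<in>K. lam k *\<^sub>R a k) \<in> (\<Sum>k\<in>K. (*\<^sub>R) (lam k) ` G k)"
    using ab fin by (subst set_sum_alt) auto
  moreover have "(\<Sum>j\<in>?J. \<mu> j *\<^sub>R y j) \<in> (\<Sum>j\<in>?J. (*\<^sub>R) (\<mu> j) ` clarke_grad (g j) x)"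
    using y J by (subst set_sum_alt) auto
  ultimately have "(\<Sum>k\<in>K. lam k *\<^sub>R a k) + (\<Sum>j\<in>?J. \<mu> j *\<^sub>R y j) + r \<in>
      (\<Sum>k\<in>K. (*\<^sub>R) (lam k) ` G k) + (\<Sum>j\<in>?J. (*\<^sub>R) (\<mu> j) ` clarke_grad (g j) x) + cball 0 e"
    by (intro set_plus_intro r)
  then have zero: "0 \<in> (\<Sum>k\<in>K. (*\<^sub>R) (lam k) ` G k) +
      (\<Sum>j\<in>?J. (*\<^sub>R) (\<mu> j) ` clarke_grad (g j) x) + cball 0 e"
    by (simp only: eq0[symmetric])
  show ?thesis
    by (intro exI[of _ lam] exI[of _ \<mu>] conjI zero lam1 ballI lam)
      (use y pos in \<open>auto simp: \<mu>_def\<close>)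
qed

section \<open>The game\<close>

text \<open>Half the sum and half the difference of the end points inherit the same constant
  \<open>L\<close>.\<close>

lemma ivl_locally_lipschitz_components:
  assumes "ivl_locally_lipschitz f" "\<phi> \<in> {center, half_width}"
  shows "locally_lipschitz (\<lambda>x. \<phi> (f x))"
  unfolding locally_lipschitz_def
proof
  fix z
  obtain U L where U: "open U" "z \<in> U" "L > 0" and lip: "\<And>u1 u2. u1 \<in> U \<Longrightarrow> u2 \<in> U \<Longrightarrow>
      max \<bar>lower (f u1) - lower (f u2)\<bar> \<bar>upper (f u1) - upper (f u2)\<bar> \<le> L * norm (u1 - u2)"
    using assms(1) unfolding ivl_locally_lipschitz_def by meson
  have "\<bar>\<phi> (f u1) - \<phi> (f u2)\<bar> \<le> L * norm (u1 - u2)" if "u1 \<in> U" "u2 \<in> U" for u1 u2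
    using lip[OF that] assms(2) unfolding center_def half_width_def by (auto; argo)
  with U show "\<exists>U L. open U \<and> z \<in> U \<and> L > 0 \<and>
      (\<forall>u1\<in>U. \<forall>u2\<in>U. \<bar>\<phi> (f u1) - \<phi> (f u2)\<bar> \<le> L * norm (u1 - u2))"
    by blast
qed

lemma clarke_grad_component_subset:
  assumes "\<phi> \<in> {center, half_width}"
  shows "clarke_grad (\<lambda>y. \<phi> (f y)) x \<subseteq> ivl_clarke_grad f x"
  using assms unfolding ivl_clarke_grad_def by (auto intro: hull_inc)

text \<open>Adding \<open>[0, e]\<close> raises both center and half-width by \<open>e / 2\<close>.
  Quantifying over \<open>\<phi>\<close> lets one argument treat the two scalarisations.\<close>

lemma not_prec_CW_add_iff:
  assumes "e \<ge> 0"
  shows "\<not> Q + Interval (0, e) \<prec>CW R \<longleftrightarrow> (\<exists>\<phi>\<in>{center, half_width}. \<phi> R \<le> \<phi> Q + e / 2)"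
proof -
  have "lower (Interval (0, e)) = 0" "upper (Interval (0, e)) = e"
    using assms by (simp_all add: lower.rep_eq upper.rep_eq Interval_inverse)
  then show ?thesis by (auto simp: prec_CW_def center_def half_width_def field_simps)
qed

lemma closed_strategy_set:
  assumes "\<And>j. j \<in> {1..p} \<Longrightarrow> continuous_on UNIV (g j)"
  shows "closed (strategy_set p g)"
proof -
  have "strategy_set p g = (\<Inter>j\<in>{1..p}. {u. g j u \<le> 0})" by (auto simp: strategy_set_def)
  then show ?thesis using assms by (auto intro!: closed_INT closed_Collect_le)
qed

theorem theorem5p1:
  fixes l m p :: nat
    and g :: "nat \<Rightarrow> nat \<Rightarrow> real^'n \<Rightarrow> real"
    and F :: "nat \<Rightarrow> nat \<Rightarrow> (nat \<Rightarrow> real^'n) \<Rightarrow> real interval"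
    and S :: "nat \<Rightarrow> (real^'n) set"
    and \<epsilon> :: "nat \<Rightarrow> real"
    and u :: "nat \<Rightarrow> real^'n"
    and \<delta> :: real
    and B :: "nat \<Rightarrow> (real^'n) set"
  defines "S \<equiv> \<lambda>i. strategy_set p (g i)"
    and "B \<equiv> \<lambda>i. {x \<in> S i. norm (x - u i) \<le> \<delta>}"
  assumes eps_nonneg: "\<forall>k\<in>{1..m}. \<epsilon> k \<ge> 0"
    and eps_nonzero: "\<exists>k\<in>{1..m}. \<epsilon> k \<noteq> 0"
    and nash: "weak_eps_nash l m S F \<epsilon> u"
    and lip_F: "\<forall>i\<in>{1..l}. \<forall>k\<in>{1..m}. ivl_locally_lipschitz (\<lambda>x. F i k (u(i := x)))"
    and lip_g: "\<forall>i\<in>{1..l}. \<forall>j\<in>{1..p}. locally_lipschitz (g i j)"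
    and delta_pos: "\<delta> > 0"
    and bcq: "\<forall>i\<in>{1..l}. \<forall>x\<in>B i. BCQ p (g i) x"
  shows "\<forall>i\<in>{1..l}. \<exists>x\<in>B i. \<exists>lam \<mu> :: nat \<Rightarrow> real.
      (\<forall>k\<in>{1..m}. lam k \<ge> 0) \<and> (\<Sum>k\<in>{1..m}. lam k) = 1 \<and>
      (\<forall>j\<in>{1..p}. \<mu> j \<ge> 0) \<and>
      0 \<in> (\<Sum>k\<in>{1..m}. (*\<^sub>R) (lam k) ` ivl_clarke_grad (\<lambda>y. F i k (u(i := y))) x)
          + (\<Sum>j\<in>active p (g i) x. (*\<^sub>R) (\<mu> j) ` clarke_grad (g i j) x)
          + (*\<^sub>R) (1 / \<delta> * Max (\<epsilon> ` {1..m})) ` cball 0 1 \<and>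
      (\<forall>j\<in>{1..p}. \<mu> j * g i j x = 0)"
proof
  fix i assume i: "i \<in> {1..l}"
  define f where "f k y = F i k (u(i := y))" for k y
  define E where "E = Max (\<epsilon> ` {1..m})"
  \<comment> \<open>This slope makes \<open>e * \<delta>\<close> equal to \<open>E / 2\<close>, the
    bound for \<open>\<Phi> (u i)\<close>.\<close>
  define e where "e = E / (2 * \<delta>)"
  \<comment> \<open>Each criterion contributes two real objectives, so \<open>h\<close> is a family
    of \<open>2 * m\<close> functions.\<close>
  define A where "A = {1..m} \<times> {center, half_width}"
  define h where "h = (\<lambda>(k, \<phi>) y. \<phi> (f k y) :: real)"
  define \<Phi> where "\<Phi> y = Max ((\<lambda>a. h a y - h a (u i) + \<epsilon> (fst a) / 2) ` A)" for y
  have eps_le: "\<epsilon> k \<le> E" if "k \<in> {1..m}" for k using that by (auto simp: E_def)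
  have "E > 0" using eps_nonneg eps_nonzero eps_le by (metis less_eq_real_def order_less_le_trans)
  then have "e > 0" using delta_pos by (simp add: e_def)
  \<comment> \<open>A nonzero tolerance has an index in \<open>{1..m}\<close>, so the maximum is
    over a nonempty set.\<close>
  have A: "finite A" "A \<noteq> {}" using eps_nonzero by (auto simp: A_def)
  have lip_h: "locally_lipschitz (h a)" if "a \<in> A" for a
    using that lip_F i unfolding A_def h_def f_def
    by (auto simp del: insert_iff intro: ivl_locally_lipschitz_components)
  have ui: "u i \<in> S i" using nash i by (auto simp: weak_eps_nash_def)
  have gcont: "continuous_on UNIV (g i j)" if "j \<in> {1..p}" for j
    using lip_g i that locally_lipschitz_continuous by blast
  have clS: "closed (S i)" unfolding S_def by (rule closed_strategy_set) (rule gcont)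
  have \<Phi>cont: "continuous_on (S i) \<Phi>"
    unfolding \<Phi>_def
    by (intro continuous_on_Max_image A continuous_intros
        continuous_on_subset[OF locally_lipschitz_continuous[OF lip_h]]) auto
  have \<Phi>nonneg: "0 \<le> \<Phi> y" if y: "y \<in> S i" for y
  proof -
    obtain k where k: "k \<in> {1..m}" "\<not> F i k (u(i := y)) + Interval (0, \<epsilon> k) \<prec>CW F i k u"
      using nash i y unfolding weak_eps_nash_def by blast
    \<comment> \<open>Here \<open>F i k u\<close> is read as \<open>f k (u i)\<close>, because
      \<open>u(i := u i) = u\<close>.\<close>
    then obtain \<phi> where \<phi>: "\<phi> \<in> {center, half_width}" "\<phi> (f k (u i)) \<le> \<phi> (f k y) + \<epsilon> k / 2"
      using eps_nonneg not_prec_CW_add_iff by (auto simp: f_def simp del: insert_iff)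
    have "0 \<le> h (k, \<phi>) y - h (k, \<phi>) (u i) + \<epsilon> (fst (k, \<phi>)) / 2" using \<phi>(2) by (simp add: h_def)
    also have "\<dots> \<le> \<Phi> y"
      unfolding \<Phi>_def using A k \<phi> by (intro Max_ge finite_imageI imageI) (simp_all add: A_def)
    finally show ?thesis .
  qed
  \<comment> \<open>At \<open>u i\<close> the differences cancel and only the shifts
    \<open>\<epsilon> k / 2\<close> remain.\<close>
  have "\<Phi> (u i) \<le> e * \<delta>"
  proof -
    have "\<Phi> (u i) \<le> E / 2"
      unfolding \<Phi>_def using A eps_le by (intro Max.boundedI) (auto simp: A_def)
    then show ?thesis using delta_pos by (simp add: e_def)
  qed
  from penalized_minimizer[OF clS ui \<Phi>cont \<Phi>nonneg this \<open>e > 0\<close>] delta_pos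
  obtain x where x: "x \<in> S i" "dist x (u i) \<le> \<delta>" and min: "\<And>y. y \<in> S i \<Longrightarrow> \<Phi> x \<le> \<Phi> y + e * dist y x"
    by auto
  have xB: "x \<in> B i" using x by (simp add: B_def dist_norm)
  have opt: "\<exists>a\<in>A. h a x \<le> h a y + e * dist y x" if "\<forall>j\<in>{1..p}. g i j y \<le> 0" for y
  proof -
    have "y \<in> S i" using that by (simp add: S_def strategy_set_def)
    \<comment> \<open>An index attaining the maximum at \<open>y\<close> is the required one: its
      term at \<open>x\<close> is at most \<open>\<Phi> x\<close>, and the constants cancel.\<close>
    have "\<Phi> y \<in> (\<lambda>a. h a y - h a (u i) + \<epsilon> (fst a) / 2) ` A"
      unfolding \<Phi>_def using A by (intro Max_in) auto
    then obtain a where a: "a \<in> A" "\<Phi> y = h a y - h a (u i) + \<epsilon> (fst a) / 2" by blast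
    have "h a x - h a (u i) + \<epsilon> (fst a) / 2 \<le> \<Phi> x" unfolding \<Phi>_def using A a by (intro Max_ge) auto
    with min[OF \<open>y \<in> S i\<close>] a show ?thesis by (intro bexI[of _ a]) auto
  qed
  let ?G = "\<lambda>k. ivl_clarke_grad (f k) x" and ?J = "active p (g i) x"
  have sub: "clarke_grad (h a) x \<subseteq> ?G (fst a)" if "a \<in> A" for a
  proof -
    obtain k \<phi> where a: "a = (k, \<phi>)" by (cases a)
    then have "\<phi> \<in> {center, half_width}" using that by (simp add: A_def)
    with a show ?thesis using clarke_grad_component_subset[of \<phi> "f k" x] by (simp add: h_def)
  qed
  have "0 \<in> convex hull ((\<Union>a\<in>A. clarke_grad (h a) x + cball 0 e) \<union>
      (\<Union>j\<in>{j\<in>{1..p}. g i j x = 0}. clarke_grad (g i j) x))"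
    using A lip_h lip_g i x(1) opt \<open>e > 0\<close>
    by (intro zero_in_hull_clarke_grads) (auto simp: S_def strategy_set_def)
  \<comment> \<open>The two scalar gradients of a criterion are absorbed into its interval
    gradient.\<close>
  also have "\<dots> \<subseteq> convex hull ((\<Union>k\<in>{1..m}. ?G k + cball 0 e) \<union> (\<Union>j\<in>?J. clarke_grad (g i j) x))"
  proof (intro hull_mono Un_mono UN_least)
    fix a assume "a \<in> A"
    then have "clarke_grad (h a) x + cball 0 e \<subseteq> ?G (fst a) + cball 0 e" "fst a \<in> {1..m}"
      using set_plus_mono2[OF sub subset_refl] by (auto simp: A_def)
    then show "clarke_grad (h a) x + cball 0 e \<subseteq> (\<Union>k\<in>{1..m}. ?G k + cball 0 e)" by blast
  qed (auto simp: active_def)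
  finally have zero: "0 \<in> convex hull ((\<Union>k\<in>{1..m}. ?G k + cball 0 e) \<union> (\<Union>j\<in>?J. clarke_grad (g i j) x))" .
  have G: "convex (?G k) \<and> ?G k \<noteq> {}" if "k \<in> {1..m}" for k
  proof -
    have "(k, center) \<in> A" using that by (simp add: A_def)
    from clarke_grad_nonempty[OF lip_h[OF this]] sub[OF this] show ?thesis
      by (auto simp: ivl_clarke_grad_def)
  qed
  have BCQ: "BCQ p (g i) x" using bcq i xB by blast
  have lip_gi: "locally_lipschitz (g i j)" if "j \<in> {1..p}" for j using lip_g i that by blast
  obtain lam \<mu> where lam: "\<forall>k\<in>{1..m}. lam k \<ge> 0" "sum lam {1..m} = 1"
    and \<mu>: "\<forall>j. \<mu> j \<ge> 0" "\<forall>j. j \<notin> ?J \<longrightarrow> \<mu> j = 0"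
    and mem: "0 \<in> (\<Sum>k\<in>{1..m}. (*\<^sub>R) (lam k) ` ?G k)
      + (\<Sum>j\<in>?J. (*\<^sub>R) (\<mu> j) ` clarke_grad (g i j) x) + cball 0 e"
    using normalized_multipliers[OF finite_atLeastAtMost G lip_gi BCQ zero less_imp_le[OF \<open>e > 0\<close>]]
    by blast
  \<comment> \<open>The ball of radius \<open>e\<close> lies in the required one, whose radius is
    \<open>2 * e\<close>.\<close>
  have "e \<le> 1 / \<delta> * E" using \<open>E > 0\<close> delta_pos by (simp add: e_def field_simps)
  moreover have "(*\<^sub>R) (1 / \<delta> * E) ` cball (0::real^'n) 1 = cball 0 (1 / \<delta> * E)"
    using cball_scale[of "1 / \<delta> * E" "0::real^'n" 1] \<open>E > 0\<close> delta_pos by simp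
  ultimately have "cball (0::real^'n) e \<subseteq> (*\<^sub>R) (1 / \<delta> * E) ` cball 0 1"
    by (simp only: subset_cball)
  then have "0 \<in> (\<Sum>k\<in>{1..m}. (*\<^sub>R) (lam k) ` ?G k)
      + (\<Sum>j\<in>?J. (*\<^sub>R) (\<mu> j) ` clarke_grad (g i j) x) + (*\<^sub>R) (1 / \<delta> * E) ` cball 0 1"
    using mem set_plus_mono2 by blast
  moreover have "\<mu> j * g i j x = 0" if "j \<in> {1..p}" for j
    using \<mu>(2) that by (auto simp: active_def)
  ultimately show "\<exists>x\<in>B i. \<exists>lam \<mu> :: nat \<Rightarrow> real.
      (\<forall>k\<in>{1..m}. lam k \<ge> 0) \<and> (\<Sum>k\<in>{1..m}. lam k) = 1 \<and>
      (\<forall>j\<in>{1..p}. \<mu> j \<ge> 0) \<and>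
      0 \<in> (\<Sum>k\<in>{1..m}. (*\<^sub>R) (lam k) ` ivl_clarke_grad (\<lambda>y. F i k (u(i := y))) x)
          + (\<Sum>j\<in>active p (g i) x. (*\<^sub>R) (\<mu> j) ` clarke_grad (g i j) x)
          + (*\<^sub>R) (1 / \<delta> * Max (\<epsilon> ` {1..m})) ` cball 0 1 \<and>
      (\<forall>j\<in>{1..p}. \<mu> j * g i j x = 0)"
    using xB lam \<mu>(1) unfolding f_def E_def by blast
qed

end
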